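(* Let $n,k,i$ be integers with $1\leq k\leq n-1$ and $0\leq i\leq n-1$. Let $d(n,k,i)$ be the smallest dimension $d$ for which there is an affine map $\pi:\Delta_{n,k}\to\mathbb{R}^d$ that strictly preserves every face of the $i$-dimensional skeleton of the hypersimplex $\Delta_{n,k}$. Then $$d(n,k,i)=\begin{cases}2k+2i &\text{if } n\geq 2k+2i+2,\\ 2n-2k+2i &\text{if } n\leq 2k-2i-2,\\ n-1 &\text{if } 2k-2i-1\leq n\leq 2k+2i+1 \text{ and } k\in A_{n,i},\\ n-2 &\text{if } 2k-2i-1\leq n\leq 2k+2i+1 \text{ and } k\notin A_{n,i},\end{cases}$$ where $A_{n,i}=\{1,2,\ldots,i+1\}\cup\{n-i-1,n-i,\ldots,n-1\}$.
   Context: The $(n,k)$-hypersimplex is $\Delta_{n,k}=\operatorname{conv}\{x\in\{0,1\}^n : \sum_{j=1}^n x_j=k\}\subset\mathbb{R}^n$. For a polytope $P$ and an affine map $\pi:P\to\pi(P)$, a face $F\subseteq P$ is strictly preserved under $\pi$ if (i) $\pi(F)$ is a face of $\pi(P)$, (ii) $\pi^{-1}(\pi(F))=F$, and (iii) the map $F\to\pi(F)$ is a bijection. Faces include the polytope itself. The $i$-dimensional skeleton consists of all faces of dimension at most $i$. *)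

theory Defs
  imports "HOL-Analysis.Analysis" "HOL-Analysis.Finite_Function_Topology"
begin

text \<open>
  The ambient space of dimension \<open>n\<close> is \<open>real ^ 'n\<close> with \<open>n = CARD('n)\<close>, so the ambient
  dimension is not an argument of the hypersimplex.
\<close>

definition hypersimplex :: "int \<Rightarrow> (real ^ 'n) set" where
  "hypersimplex k =
     convex hull {x. (\<forall>j. x $ j \<in> {0, 1}) \<and> (\<Sum>j\<in>UNIV. x $ j) = of_int k}"

text \<open>
  The target dimension \<open>d\<close> is a bound variable of the problem, so it cannot be carried by a type.
  The space of dimension \<open>d\<close> is therefore the linear subspace of the finitely supported real
  sequences whose coordinates vanish outside \<open>{0, ..., d - 1}\<close>.
\<close>

definition coord_space :: "nat \<Rightarrow> (nat \<Rightarrow>\<^sub>0 real) set" where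
  "coord_space d = {y. Poly_Mapping.keys y \<subseteq> {..<d}}"

definition affine_map_on :: "'a::real_vector set \<Rightarrow> ('a \<Rightarrow> 'b::real_vector) \<Rightarrow> bool" where
  "affine_map_on P \<pi> \<longleftrightarrow> (\<exists>L c. linear L \<and> (\<forall>x\<in>P. \<pi> x = L x + c))"

definition strictly_preserved ::
    "('a::real_vector \<Rightarrow> 'b::real_vector) \<Rightarrow> 'a set \<Rightarrow> 'a set \<Rightarrow> bool" where
  "strictly_preserved \<pi> P F \<longleftrightarrow>
     (\<pi> ` F) face_of (\<pi> ` P) \<and>
     {x \<in> P. \<pi> x \<in> \<pi> ` F} = F \<and>
     bij_betw \<pi> F (\<pi> ` F)"

definition preserves_skeleton ::
    "('a::euclidean_space \<Rightarrow> 'b::real_vector) \<Rightarrow> 'a set \<Rightarrow> int \<Rightarrow> bool" where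
  "preserves_skeleton \<pi> P i \<longleftrightarrow>
     (\<forall>F. F face_of P \<and> aff_dim F \<le> i \<longrightarrow> strictly_preserved \<pi> P F)"

definition min_preserving_dim :: "'a::euclidean_space set \<Rightarrow> int \<Rightarrow> nat" where
  "min_preserving_dim P i =
     (LEAST d. \<exists>\<pi> :: 'a \<Rightarrow> (nat \<Rightarrow>\<^sub>0 real).
        affine_map_on P \<pi> \<and> \<pi> ` P \<subseteq> coord_space d \<and> preserves_skeleton \<pi> P i)"

definition A_set :: "int \<Rightarrow> int \<Rightarrow> int set" where
  "A_set n i = {1..i + 1} \<union> {n - i - 1..n - 1}"

end

theory Submission
  imports Defs
begin

text \<open>
  The map \<open>L x + c\<close> strictly preserves the \<open>i\<close>-skeleton iff no nonzero \<open>v\<close> in the kernel \<open>K\<close> of \<open>L\<close>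
  on the hyperplane \<open>\<Sum>v = 0\<close> points from a face of dimension at most \<open>i\<close> into the hypersimplex. As
  the faces fix some coordinates to 0 and others to 1, this says that each such \<open>v\<close> has at least
  \<open>k + i + 1\<close> negative or at least \<open>n - k + i + 1\<close> positive entries.

  Passing to \<open>-v\<close> shows that the condition is invariant under \<open>k \<mapsto> n - k\<close>, so let \<open>2k \<le> n\<close>. Then
  every nonzero \<open>v \<in> K\<close> either has \<open>n - k + i + 1\<close> entries of one sign, or \<open>k + i + 1\<close> entries of both
  signs. If \<open>dim K \<ge> 2\<close>, then \<open>K - {0}\<close> is connected, so that \<open>v\<close> and \<open>-v\<close> are of the same type and
  only the last alternative remains; a \<open>v \<in> K\<close> vanishing on \<open>dim K - 1\<close> coordinates then yields
  \<open>dim K \<le> n - 1 - 2k - 2i\<close>. The moment curve attains this bound. If \<open>n \<le> 2k + 2i + 1\<close>, only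
  \<open>dim K \<le> 1\<close> is left, and a line of the first type exists iff \<open>k \<ge> i + 2\<close>: take \<open>n e\<^sub>b - (1, ..., 1)\<close>.
\<close>

section \<open>The hypersimplex as a slice of the cube, and its vertices\<close>

definition negs :: "real ^ 'n \<Rightarrow> 'n::finite set" where
  "negs v = {j. v $ j < 0}"

definition poss :: "real ^ 'n \<Rightarrow> 'n::finite set" where
  "poss v = {j. v $ j > 0}"

definition fracs :: "real ^ 'n \<Rightarrow> 'n::finite set" where
  "fracs x = {j. 0 < x $ j \<and> x $ j < 1}"

text \<open>The hypersimplex by inequalities. The level \<open>k\<close> is a natural number here,
  ready for comparison with cardinalities.\<close>

definition slab :: "nat \<Rightarrow> (real ^ 'n) set" where
  "slab k = {x. (\<forall>j. 0 \<le> x $ j \<and> x $ j \<le> 1) \<and> (\<Sum>j\<in>UNIV. x $ j) = real k}"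

text \<open>Each coordinate tolerates some positive step along \<open>u\<close>, and there are
  finitely many coordinates, so the smallest of these steps suits all of them. The two sign
  conditions say that \<open>u\<close> is a feasible direction at \<open>x\<close>.\<close>

lemma slab_perturb:
  fixes x u :: "real ^ 'n"
  assumes x: "x \<in> slab k" and u0: "(\<Sum>j\<in>UNIV. u $ j) = 0"
    and lo: "\<And>j. u $ j < 0 \<Longrightarrow> 0 < x $ j" and hi: "\<And>j. 0 < u $ j \<Longrightarrow> x $ j < 1"
  shows "\<exists>\<epsilon>>0. x + \<epsilon> *\<^sub>R u \<in> slab k"
proof -
  have x01: "0 \<le> x $ j" "x $ j \<le> 1" for j
    using x by (auto simp: slab_def)
  have "\<exists>e>0. \<forall>t. 0 \<le> t \<and> t \<le> e \<longrightarrow> 0 \<le> x $ j + t * u $ j \<and> x $ j + t * u $ j \<le> 1" for j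
  proof -
    consider "u $ j = 0" | "u $ j < 0" | "u $ j > 0" by linarith
    then show ?thesis
    proof cases
      case 1
      then show ?thesis using x01[of j] by (intro exI[of _ 1]) auto
    next
      case 2
      have "0 \<le> x $ j + t * u $ j \<and> x $ j + t * u $ j \<le> 1"
        if "0 \<le> t" "t \<le> x $ j / - u $ j" for t
      proof -
        have "t * - u $ j \<le> x $ j" using that 2 by (simp add: field_simps)
        moreover have "t * u $ j \<le> 0" using that 2 by (simp add: mult_nonneg_nonpos)
        ultimately show ?thesis using x01[of j] by auto
      qed
      moreover have "x $ j / - u $ j > 0" using 2 lo[OF 2] by (simp add: divide_pos_neg)
      ultimately show ?thesis by blast
    next
      case 3
      have "0 \<le> x $ j + t * u $ j \<and> x $ j + t * u $ j \<le> 1"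
        if "0 \<le> t" "t \<le> (1 - x $ j) / u $ j" for t
      proof -
        have "t * u $ j \<le> 1 - x $ j" using that 3 by (simp add: field_simps)
        moreover have "t * u $ j \<ge> 0" using that 3 by simp
        ultimately show ?thesis using x01[of j] by auto
      qed
      moreover have "(1 - x $ j) / u $ j > 0" using 3 hi[OF 3] by simp
      ultimately show ?thesis by blast
    qed
  qed
  then obtain e where e: "\<And>j. e j > 0"
    "\<And>j t. 0 \<le> t \<Longrightarrow> t \<le> e j \<Longrightarrow> 0 \<le> x $ j + t * u $ j \<and> x $ j + t * u $ j \<le> 1"
    by metis
  have "(\<Sum>j\<in>UNIV. x $ j + t * u $ j) = real k" for t
    using x u0 by (simp add: sum.distrib slab_def flip: sum_distrib_left)
  moreover have "Min (range e) > 0" using e(1) by simp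
  moreover have "0 \<le> x $ j + Min (range e) * u $ j \<and> x $ j + Min (range e) * u $ j \<le> 1" for j
    using e(2)[of "Min (range e)" j] \<open>Min (range e) > 0\<close> by (auto simp: less_imp_le)
  ultimately show ?thesis
    by (intro exI[of _ "Min (range e)"]) (auto simp: slab_def)
qed

text \<open>Fractional coordinates can move both ways, so \<open>y\<close> lies strictly between two
  points of the slab on the line along \<open>u\<close>, and the face must contain both.\<close>

lemma face_of_slab_perturb:
  fixes y u :: "real ^ 'n"
  assumes F: "F face_of slab k" and y: "y \<in> F" and u0: "(\<Sum>j\<in>UNIV. u $ j) = 0"
    and supp: "\<And>j. u $ j \<noteq> 0 \<Longrightarrow> j \<in> fracs y"
  shows "\<exists>\<epsilon>>0. y + \<epsilon> *\<^sub>R u \<in> F"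
proof -
  have yS: "y \<in> slab k" using F y face_of_imp_subset by blast
  have pr: "0 < y $ j \<and> y $ j < 1" if "u $ j \<noteq> 0" for j
    using supp[OF that] by (simp add: fracs_def)
  obtain e where e: "e > 0" "y + e *\<^sub>R u \<in> slab k"
    using slab_perturb[OF yS u0] pr by force
  obtain e' where e': "e' > 0" "y + e' *\<^sub>R (-u) \<in> slab k"
    using slab_perturb[OF yS, of "-u"] u0 pr by (force simp: sum_negf)
  have "y + e *\<^sub>R u \<in> F"
  proof (cases "u = 0")
    case False
    \<comment> \<open>The weight \<open>e' / (e + e')\<close> balances the two step lengths, so that
      the multiples of \<open>u\<close> cancel.\<close>
    have "y \<in> open_segment (y + e' *\<^sub>R (-u)) (y + e *\<^sub>R u)"
      unfolding in_segment
    proof (intro conjI exI[of _ "e' / (e + e')"])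
      show "y + e' *\<^sub>R - u \<noteq> y + e *\<^sub>R u"
      proof
        assume "y + e' *\<^sub>R - u = y + e *\<^sub>R u"
        then have "(e + e') *\<^sub>R u = 0" by (simp add: algebra_simps)
        with False e e' show False by simp
      qed
      have "(1 - e' / (e + e')) * e' = e' / (e + e') * e"
        using e e' by (simp add: field_simps)
      then have "((1 - e' / (e + e')) * e') *\<^sub>R u = (e' / (e + e') * e) *\<^sub>R u"
        by simp
      then show "y = (1 - e' / (e + e')) *\<^sub>R (y + e' *\<^sub>R - u) + (e' / (e + e')) *\<^sub>R (y + e *\<^sub>R u)"
        unfolding scaleR_add_right scaleR_scaleR scaleR_minus_right by (simp add: algebra_simps)
    qed (use e e' in auto)
    then show ?thesis using F y e e' unfolding face_of_def by blast
  qed (use y in simp)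
  with e show ?thesis by blast
qed

lemma sum_axis_diff:
  fixes a b :: "'n::finite"
  shows "(\<Sum>j\<in>UNIV. (axis a (1::real) - axis b 1) $ j) = 0"
  by (simp add: sum_subtractf axis_def)

lemma slab_sum_fracs:
  fixes x :: "real ^ 'n"
  assumes "x \<in> slab k"
  shows "real k = real (card {j. x $ j = 1}) + (\<Sum>j\<in>fracs x. x $ j)"
proof -
  have x01: "0 \<le> x $ j" "x $ j \<le> 1" for j
    using assms by (auto simp: slab_def)
  have un: "UNIV = {j. x $ j = 0} \<union> ({j. x $ j = 1} \<union> fracs x)"
    using x01 by (force simp: fracs_def less_eq_real_def)
  have "real k = (\<Sum>j\<in>UNIV. x $ j)" using assms by (simp add: slab_def)
  also have "\<dots> = (\<Sum>j\<in>{j. x $ j = 0}. x $ j) + ((\<Sum>j\<in>{j. x $ j = 1}. x $ j) + (\<Sum>j\<in>fracs x. x $ j))"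
    apply (subst un)
    apply (subst sum.union_disjoint)
       apply (auto simp: fracs_def)
    apply (subst sum.union_disjoint)
       apply (auto simp: fracs_def)
    done
  finally show ?thesis by simp
qed

text \<open>A single fractional coordinate is impossible because \<open>k\<close> is an integer. Two
  of them would let \<open>x\<close> move along the difference of their unit vectors inside the face
  \<open>{x}\<close>.\<close>

lemma extreme_point_of_slab:
  fixes x :: "real ^ 'n"
  assumes "x extreme_point_of slab k"
  shows "fracs x = {}"
proof (rule ccontr)
  assume "fracs x \<noteq> {}"
  then obtain a where a: "a \<in> fracs x" by blast
  have xS: "x \<in> slab k" using assms by (simp add: extreme_point_of_def)
  have "fracs x \<noteq> {a}"
  proof
    assume "fracs x = {a}"
    then have "real k = real (card {j. x $ j = 1}) + x $ a"
      using slab_sum_fracs[OF xS] by simp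
    then have "x $ a = of_int (int k - int (card {j. x $ j = 1}))" by simp
    moreover have "0 < x $ a" "x $ a < 1" using a by (auto simp: fracs_def)
    ultimately have "0 < int k - int (card {j. x $ j = 1})" "int k - int (card {j. x $ j = 1}) < 1"
      by (metis of_int_0_less_iff, metis of_int_less_1_iff)
    then show False by linarith
  qed
  then obtain b where b: "b \<in> fracs x" "b \<noteq> a" using a by blast
  have "{x} face_of slab k" using assms face_of_singleton by blast
  from face_of_slab_perturb[OF this, of x "axis a 1 - axis b 1"]
  obtain e where "e > 0" "x + e *\<^sub>R (axis a 1 - axis b 1) = x"
    using a b sum_axis_diff[of a b] by (force simp: axis_def split: if_splits)
  then have "(axis a (1::real) - axis b 1 :: real ^ 'n) = 0" by simp
  then have "(axis a (1::real) - axis b 1 :: real ^ 'n) $ a = 0" by simp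
  with b show False by (simp add: axis_def)
qed

lemma convex_slab: "convex (slab k :: (real ^ 'n) set)"
proof -
  have "slab k = {x::real^'n. (\<forall>j. 0 \<le> x $ j \<and> x $ j \<le> 1)} \<inter> {x. (\<Sum>j\<in>UNIV. x $ j) = real k}"
    by (auto simp: slab_def)
  moreover have "{x::real^'n. (\<forall>j. 0 \<le> x $ j \<and> x $ j \<le> 1)} = cbox 0 1"
    by (auto simp: mem_box_cart)
  moreover have "convex {x::real^'n. (\<Sum>j\<in>UNIV. x $ j) = real k}"
    by (auto simp: convex_def sum.distrib simp flip: sum_distrib_left distrib_right)
  ultimately show ?thesis by (simp add: convex_Int)
qed

lemma compact_slab: "compact (slab k :: (real ^ 'n) set)"
proof -
  have "slab k = {x::real^'n. (\<Sum>j\<in>UNIV. x $ j) = real k} \<inter> cbox 0 1"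
    by (auto simp: slab_def mem_box_cart)
  moreover have "closed {x::real^'n. (\<Sum>j\<in>UNIV. x $ j) = real k}"
    by (intro closed_Collect_eq continuous_intros)
  ultimately show ?thesis by (metis closed_Int_compact compact_cbox)
qed

text \<open>The nontrivial inclusion is Krein-Milman: the slab is compact and convex, and its
  extreme points are 0/1 vectors of coordinate sum \<open>k\<close>.\<close>

lemma hypersimplex_eq_slab: "(hypersimplex (int k) :: (real ^ 'n) set) = slab k"
proof
  show "(hypersimplex (int k) :: (real ^ 'n) set) \<subseteq> slab k"
    unfolding hypersimplex_def
  proof (intro hull_minimal convex_slab subsetI)
    fix x :: "real ^ 'n"
    assume x: "x \<in> {x. (\<forall>j. x $ j \<in> {0, 1}) \<and> (\<Sum>j\<in>UNIV. x $ j) = of_int (int k)}"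
    then have "0 \<le> x $ j \<and> x $ j \<le> 1" for j by (cases "x $ j = 0") auto
    with x show "x \<in> slab k" by (auto simp: slab_def)
  qed
  have "{x::real^'n. x extreme_point_of slab k} \<subseteq> {x. (\<forall>j. x $ j \<in> {0, 1}) \<and> (\<Sum>j\<in>UNIV. x $ j) = of_int (int k)}"
  proof safe
    fix x :: "real^'n" and j assume x: "x extreme_point_of slab k" and "x $ j \<noteq> 0" 
    moreover have "x \<in> slab k" using x by (simp add: extreme_point_of_def)
    moreover have "j \<notin> fracs x" using extreme_point_of_slab[OF x] by simp
    ultimately show "x $ j = 1" by (force simp: slab_def fracs_def less_eq_real_def)
  next
    fix x :: "real^'n" assume "x extreme_point_of slab k"
    then show "(\<Sum>j\<in>UNIV. x $ j) = of_int (int k)" by (simp add: extreme_point_of_def slab_def)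
  qed
  then show "slab k \<subseteq> (hypersimplex (int k) :: (real ^ 'n) set)"
    unfolding hypersimplex_def 
    by (subst Krein_Milman_Minkowski[OF compact_slab convex_slab]) (rule hull_mono)
qed

section \<open>Faces, fractional coordinates and the kernel criterion\<close>

text \<open>For a fixed fractional \<open>b\<close>, the face allows moves along
  \<open>axis a 1 - axis b 1\<close> for every fractional \<open>a\<close>. Adjoining
  \<open>axis b 1\<close> to these directions yields all the unit vectors at the cost of one
  dimension, hence the \<open>+ 1\<close>.\<close>

lemma card_fracs_le:
  fixes y :: "real ^ 'n"
  assumes F: "F face_of slab k" and y: "y \<in> F" and ne: "fracs y \<noteq> {}"
  shows "int (card (fracs y)) \<le> aff_dim F + 1"
proof -
  obtain b where b: "b \<in> fracs y" using ne by blast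
  define G where "G = (+) (- y) ` F"
  have G: "axis a 1 - axis b 1 \<in> span G" if a: "a \<in> fracs y" for a
  proof -
    obtain e where e: "e > 0" "y + e *\<^sub>R (axis a 1 - axis b 1) \<in> F"
      using face_of_slab_perturb[OF F y, of "axis a 1 - axis b 1"] a b sum_axis_diff[of a b]
      by (force simp: axis_def split: if_splits)
    then have "e *\<^sub>R (axis a 1 - axis b 1) \<in> G" by (force simp: G_def)
    then have "(1/e) *\<^sub>R e *\<^sub>R (axis a 1 - axis b 1) \<in> span G" 
      by (intro span_scale span_base)
    then show ?thesis using e by simp
  qed
  let ?B = "(\<lambda>a. axis a (1::real)) ` fracs y"
  have "?B \<subseteq> span (insert (axis b 1) G)"
  proof safe
    fix a assume "a \<in> fracs y"
    then have "(axis a 1 - axis b 1) + axis b 1 \<in> span (insert (axis b 1) G)"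
      using G by (intro span_add) (auto intro: span_base span_mono[THEN subsetD])
    then show "axis a 1 \<in> span (insert (axis b 1) G)" by simp
  qed
  moreover have "independent ?B"
    by (rule independent_mono[OF independent_Basis]) (auto simp: Basis_vec_def)
  ultimately have "card ?B \<le> dim (insert (axis b 1) G)"
    by (metis independent_card_le_dim dim_span)
  also have "\<dots> \<le> dim G + 1" by (simp add: dim_insert)
  finally have "card (fracs y) \<le> dim G + 1"
    by (simp add: card_image inj_on_def axis_eq_axis)
  moreover have "aff_dim F = int (dim G)"
    unfolding G_def by (rule aff_dim_eq_dim) (simp add: y hull_inc)
  ultimately show ?thesis by simp
qed

text \<open>The sign condition on kernel vectors. The second alternative is
  \<open>n - k + i < card (poss v)\<close>, written without truncated subtraction.\<close>

definition escapes :: "nat \<Rightarrow> nat \<Rightarrow> real ^ 'n \<Rightarrow> bool" where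
  "escapes k i v \<longleftrightarrow> k + i < card (negs v) \<or> CARD('n) + i < card (poss v) + k"

text \<open>If \<open>x\<close> in the slab and \<open>y\<close> in \<open>F\<close> have the same
  image, then \<open>x - y\<close> is a kernel vector that is negative only where \<open>y\<close>
  is positive, and positive only where \<open>y\<close> is below 1. As \<open>y\<close> has at most
  \<open>i + 1\<close> fractional coordinates, these places are too few for \<open>x - y\<close> to
  escape.\<close>

lemma strictly_preserved_slab:
  fixes \<pi> :: "real ^ 'n \<Rightarrow> 'b::real_vector"
  assumes L: "linear L" and \<pi>: "\<And>x. x \<in> slab k \<Longrightarrow> \<pi> x = L x + c"
    and esc: "\<And>v. (\<Sum>j\<in>UNIV. v $ j) = 0 \<Longrightarrow> L v = 0 \<Longrightarrow> v \<noteq> 0 \<Longrightarrow> escapes k i v"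
    and F: "F face_of slab k" and dimF: "aff_dim F \<le> int i"
  shows "strictly_preserved \<pi> (slab k) F"
proof -
  have FS: "F \<subseteq> slab k" using F by (rule face_of_imp_subset)
  \<comment> \<open>Fibres through \<open>F\<close> are trivial, which gives all three conditions, that of the image face included.\<close>
  have fibre: "x = y" if x: "x \<in> slab k" and y: "y \<in> F" and eq: "\<pi> x = \<pi> y" for x y
  proof (rule ccontr)
    assume "x \<noteq> y"
    have yS: "y \<in> slab k" using y FS by blast
    have "L (x - y) = 0"
      using eq x yS \<pi> L by (simp add: linear_diff)
    moreover have "(\<Sum>j\<in>UNIV. (x - y) $ j) = 0"
      using x yS by (simp add: slab_def sum_subtractf)
    ultimately have e: "escapes k i (x - y)" using esc \<open>x \<noteq> y\<close> by simp
    have x01: "0 \<le> x $ j" "x $ j \<le> 1" and y01: "0 \<le> y $ j" "y $ j \<le> 1" for j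
      using x yS by (auto simp: slab_def)
    let ?O = "{j. y $ j = 1}" and ?Z = "{j. y $ j = 0}"
    have ksum: "real k = real (card ?O) + (\<Sum>j\<in>fracs y. y $ j)"
      using slab_sum_fracs[OF yS] .
    have un: "UNIV = ?Z \<union> (?O \<union> fracs y)"
      using y01 by (force simp: fracs_def less_eq_real_def)
    have "CARD('n) = card ?Z + card (?O \<union> fracs y)"
      by (subst un, rule card_Un_disjoint) (auto simp: fracs_def)
    also have "card (?O \<union> fracs y) = card ?O + card (fracs y)"
      by (rule card_Un_disjoint) (auto simp: fracs_def)
    finally have cards: "CARD('n) = card ?Z + (card ?O + card (fracs y))" .
    have "negs (x - y) \<subseteq> ?O \<union> fracs y"
    proof
      fix j assume "j \<in> negs (x - y)"
      then have "y $ j > 0" using x01[of j] by (simp add: negs_def)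
      then show "j \<in> ?O \<union> fracs y" using y01[of j] by (auto simp: fracs_def)
    qed
    then have neg: "card (negs (x - y)) \<le> card ?O + card (fracs y)"
      by (meson card_Un_le card_mono finite le_trans)
    have "poss (x - y) \<subseteq> ?Z \<union> fracs y"
    proof
      fix j assume "j \<in> poss (x - y)"
      then have "y $ j < 1" using x01[of j] by (simp add: poss_def)
      then show "j \<in> ?Z \<union> fracs y" using y01[of j] by (auto simp: fracs_def)
    qed
    then have pos: "card (poss (x - y)) \<le> card ?Z + card (fracs y)"
      by (meson card_Un_le card_mono finite le_trans)
    show False
    proof (cases "fracs y = {}")
      case True
      then show ?thesis using ksum cards neg pos e by (simp add: escapes_def)
    next
      case False
      have "int (card (fracs y)) \<le> int i + 1"
        using card_fracs_le[OF F y False] dimF by linarith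
      moreover have "(\<Sum>j\<in>fracs y. y $ j) > 0"
        using False by (intro sum_pos) (auto simp: fracs_def)
      moreover have "(\<Sum>j\<in>fracs y. y $ j) < (\<Sum>j\<in>fracs y. 1)"
        using False by (intro sum_strict_mono) (auto simp: fracs_def)
      \<comment> \<open>The fractional coordinates contribute strictly between 0 and their number to
        the sum \<open>k\<close>. This strictness on both sides brings the counts down from
        \<open>k + i + 1\<close> and \<open>n - k + i + 1\<close> to \<open>k + i\<close> and
        \<open>n - k + i\<close>.\<close>
      ultimately have "card ?O < k" "k < card ?O + card (fracs y)" "card (fracs y) \<le> i + 1"
        using ksum by auto
      then show ?thesis using cards neg pos e by (simp add: escapes_def)
    qed
  qed
  have "(\<pi> ` F) face_of (\<pi> ` slab k)"
    unfolding face_of_def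
  proof (intro conjI ballI impI)
    show "\<pi> ` F \<subseteq> \<pi> ` slab k" using FS by blast
    have "convex ((\<lambda>x. L x + c) ` F)"
      using convex_translation[OF convex_linear_image[OF L face_of_imp_convex[OF F]], of c]
      by (simp add: image_image add.commute)
    then show "convex (\<pi> ` F)"
      using FS \<pi> by (metis (no_types, lifting) image_cong subsetD)
    fix p q z assume p: "p \<in> \<pi> ` slab k" and q: "q \<in> \<pi> ` slab k" and z: "z \<in> \<pi> ` F"
      and seg: "z \<in> open_segment p q"
    obtain a b y where a: "a \<in> slab k" "p = \<pi> a" and b: "b \<in> slab k" "q = \<pi> b"
      and y: "y \<in> F" "z = \<pi> y" using p q z by blast
    obtain u where u: "0 < u" "u < 1" "z = (1 - u) *\<^sub>R p + u *\<^sub>R q"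
      using seg by (auto simp: in_segment)
    \<comment> \<open>The same convex combination, taken among preimages. Triviality of the fibre
      identifies it with \<open>y\<close>, so the face property of \<open>F\<close> applies before
      projecting.\<close>
    define x where "x = (1 - u) *\<^sub>R a + u *\<^sub>R b"
    have xS: "x \<in> slab k"
      unfolding x_def using a b u by (intro convexD[OF convex_slab]) auto
    have "L x = (1 - u) *\<^sub>R L a + u *\<^sub>R L b"
      unfolding x_def by (simp only: linear_add[OF L] linear_scale[OF L])
    then have "L x + c = (1 - u) *\<^sub>R p + u *\<^sub>R q"
      unfolding a b using \<pi>[OF a(1)] \<pi>[OF b(1)] by (simp add: algebra_simps)
    then have "\<pi> x = \<pi> y" using \<pi>[OF xS] u y by simp
    then have "x = y" using fibre xS y by blast
    moreover have "a \<noteq> b" using seg a b by auto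
    ultimately have "y \<in> open_segment a b" using u by (auto simp: in_segment x_def)
    then have "a \<in> F \<and> b \<in> F" using F a b y unfolding face_of_def by blast
    then show "p \<in> \<pi> ` F" "q \<in> \<pi> ` F" using a b by auto
  qed
  moreover have "{x \<in> slab k. \<pi> x \<in> \<pi> ` F} = F"
    using fibre FS by blast
  moreover have "inj_on \<pi> F"
    using fibre FS by (auto simp: inj_on_def)
  ultimately show ?thesis
    by (simp add: strictly_preserved_def bij_betw_def)
qed

text \<open>The smallest face containing \<open>x\<close>: its directions are supported on the
  fractional coordinates and have sum 0. Without fractional coordinates it is \<open>{x}\<close>,
  which agrees with the truncated \<open>0 - 1 = 0\<close>.\<close>

lemma slab_face_through:
  fixes x :: "real ^ 'n"
  assumes x: "x \<in> slab k"
  defines "F \<equiv> {y \<in> slab k. \<forall>j. (x $ j = 0 \<longrightarrow> y $ j = 0) \<and> (x $ j = 1 \<longrightarrow> y $ j = 1)}"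
  shows "F face_of slab k" "aff_dim F \<le> int (card (fracs x) - 1)"
proof -
  show "F face_of slab k"
    unfolding face_of_def
  proof (intro conjI ballI impI)
    show "F \<subseteq> slab k" by (auto simp: F_def)
    show "convex F"
      unfolding convex_def
    proof (intro ballI allI impI)
      fix a b :: "real ^ 'n" and u v :: real
      assume "a \<in> F" "b \<in> F" and uv: "0 \<le> u" "0 \<le> v" "u + v = 1"
      moreover then have "u *\<^sub>R a + v *\<^sub>R b \<in> slab k"
        by (intro convexD[OF convex_slab]) (auto simp: F_def)
      ultimately show "u *\<^sub>R a + v *\<^sub>R b \<in> F" by (auto simp: F_def)
    qed
    fix a b z assume a: "a \<in> slab k" and b: "b \<in> slab k" and z: "z \<in> F" and "z \<in> open_segment a b"
    then obtain u where u: "0 < u" "u < 1" "z = (1 - u) *\<^sub>R a + u *\<^sub>R b"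
      by (auto simp: in_segment)
    have 0: "a $ j = 0 \<and> b $ j = 0" if "x $ j = 0" for j
    proof -
      have "(1 - u) * a $ j + u * b $ j = 0" using z u that by (simp add: F_def)
      moreover have "(1 - u) * a $ j \<ge> 0" "u * b $ j \<ge> 0" using a b u by (auto simp: slab_def)
      ultimately have "(1 - u) * a $ j = 0" "u * b $ j = 0" by linarith+
      then show ?thesis using u by simp
    qed
    have 1: "a $ j = 1 \<and> b $ j = 1" if "x $ j = 1" for j
    proof -
      have "(1 - u) * a $ j + u * b $ j = 1" using z u that by (simp add: F_def)
      then have "(1 - u) * (1 - a $ j) + u * (1 - b $ j) = 0" by (simp add: algebra_simps)
      moreover have "(1 - u) * (1 - a $ j) \<ge> 0" "u * (1 - b $ j) \<ge> 0"
        using a b u by (auto simp: slab_def)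
      ultimately have "(1 - u) * (1 - a $ j) = 0" "u * (1 - b $ j) = 0" by linarith+
      then show ?thesis using u by simp
    qed
    show "a \<in> F" "b \<in> F" using a b 0 1 by (auto simp: F_def)
  qed
  have xF: "x \<in> F" using x by (simp add: F_def)
  have off: "(y - x) $ j = 0" if "y \<in> F" "j \<notin> fracs x" for y j
  proof -
    have "x $ j = 0 \<or> x $ j = 1" using x that(2) by (force simp: slab_def fracs_def less_eq_real_def)
    then show ?thesis using that(1) by (auto simp: F_def)
  qed
  have sum0: "(\<Sum>j\<in>UNIV. (y - x) $ j) = 0" if "y \<in> F" for y
    using that x by (simp add: F_def slab_def sum_subtractf)
  obtain B where B: "finite B" "card B \<le> card (fracs x) - 1" "\<And>y. y \<in> F \<Longrightarrow> y - x \<in> span B"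
  proof (cases "fracs x = {}")
    case True
    have "y - x = 0" if "y \<in> F" for y using off[OF that] True by (simp add: vec_eq_iff)
    then show ?thesis by (intro that[of "{}"]) auto
  next
    case False
    then obtain b where b: "b \<in> fracs x" by blast
    let ?g = "\<lambda>a. axis a 1 - axis b 1 :: real ^ 'n"
    show ?thesis
    proof (rule that[of "?g ` (fracs x - {b})"])
      show "card (?g ` (fracs x - {b})) \<le> card (fracs x) - 1"
        using b card_image_le[of "fracs x - {b}" ?g] by simp
      fix y assume y: "y \<in> F"
      define w where "w = y - x"
      have "(\<Sum>j\<in>UNIV. w $ j) = w $ b + (\<Sum>a\<in>fracs x - {b}. w $ a)"
        using off[OF y] b
        by (subst sum.mono_neutral_right[of UNIV "fracs x"]) (auto simp: w_def sum.remove)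
      \<comment> \<open>Because the entries of \<open>w\<close> sum to 0, the expansion below, with
        coefficients from the other fractional coordinates, also gets the entry at \<open>b\<close>
        right.\<close>
      then have wb: "(\<Sum>a\<in>fracs x - {b}. w $ a) = - w $ b"
        using sum0[OF y] by (simp add: w_def)
      have "w = (\<Sum>a\<in>fracs x - {b}. w $ a *\<^sub>R ?g a)"
      proof (subst vec_eq_iff, intro allI)
        fix j
        have "(\<Sum>a\<in>fracs x - {b}. w $ a *\<^sub>R ?g a) $ j
            = (\<Sum>a\<in>fracs x - {b}. w $ a * (if j = a then 1 else 0))
              - (\<Sum>a\<in>fracs x - {b}. w $ a) * (if j = b then 1 else 0)"
          by (simp only: sum_component vector_scaleR_component vector_minus_component real_scaleR_def
              axis_def vec_lambda_beta right_diff_distrib sum_subtractf sum_distrib_right)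
        also have "(\<Sum>a\<in>fracs x - {b}. w $ a * (if j = a then 1 else 0))
            = (if j \<in> fracs x - {b} then w $ j else 0)"
          by (simp add: mult_delta_right)
        also have "\<dots> - (\<Sum>a\<in>fracs x - {b}. w $ a) * (if j = b then 1 else 0) = w $ j"
          unfolding wb using off[OF y, of j] b by (auto simp: w_def)
        finally show "w $ j = (\<Sum>a\<in>fracs x - {b}. w $ a *\<^sub>R ?g a) $ j" by simp
      qed
      then show "y - x \<in> span (?g ` (fracs x - {b}))"
        unfolding w_def[symmetric]
        by (metis (no_types, lifting) imageI span_base span_scale span_sum)
    qed simp
  qed
  have "aff_dim F = int (dim ((+) (- x) ` F))"
    by (rule aff_dim_eq_dim) (simp add: xF hull_inc)
  also have "dim ((+) (- x) ` F) \<le> card B"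
    using B by (intro dim_le_card) auto
  finally show "aff_dim F \<le> int (card (fracs x) - 1)" using B(2) by simp
qed

text \<open>A small step from \<open>x\<close> along \<open>v\<close> stays in the slab and does not
  change the image. The preimage condition keeps it in the face through \<open>x\<close>, where
  injectivity forces the step to be 0.\<close>

lemma preserves_skeleton_kernel:
  fixes \<pi> :: "real ^ 'n \<Rightarrow> 'b::real_vector"
  assumes L: "linear L" and \<pi>: "\<And>x. x \<in> slab k \<Longrightarrow> \<pi> x = L x + c"
    and pres: "preserves_skeleton \<pi> (slab k) (int i)"
    and x: "x \<in> slab k" "card (fracs x) \<le> i + 1"
    and v: "(\<Sum>j\<in>UNIV. v $ j) = 0" "L v = 0"
    and lo: "\<And>j. v $ j < 0 \<Longrightarrow> 0 < x $ j" and hi: "\<And>j. 0 < v $ j \<Longrightarrow> x $ j < 1"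
  shows "v = 0"
proof -
  define F where "F = {y \<in> slab k. \<forall>j. (x $ j = 0 \<longrightarrow> y $ j = 0) \<and> (x $ j = 1 \<longrightarrow> y $ j = 1)}"
  have "F face_of slab k" "aff_dim F \<le> int i"
    using slab_face_through[OF x(1)] x(2) by (auto simp: F_def)
  then have sp: "strictly_preserved \<pi> (slab k) F"
    using pres by (simp add: preserves_skeleton_def)
  have xF: "x \<in> F" using x by (simp add: F_def)
  obtain e where e: "e > 0" "x + e *\<^sub>R v \<in> slab k"
    using slab_perturb[OF x(1) v(1) lo hi] by blast
  have "\<pi> (x + e *\<^sub>R v) = \<pi> x"
    using \<pi>[OF e(2)] \<pi>[OF x(1)] v L by (simp add: linear_add linear_scale)
  moreover then have "x + e *\<^sub>R v \<in> F" using sp e xF by (auto simp: strictly_preserved_def)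
  moreover have "inj_on \<pi> F" using sp by (simp add: strictly_preserved_def bij_betw_def)
  ultimately have "x + e *\<^sub>R v = x" using xF by (meson inj_onD)
  then show ?thesis using e by simp
qed

lemma ex_slab_point_negs:
  fixes v :: "real ^ 'n"
  assumes "1 \<le> k" "k < card (negs v)" "card (negs v) \<le> k + i"
  shows "\<exists>x\<in>slab k. card (fracs x) \<le> i + 1 \<and> (\<forall>j. v $ j < 0 \<longrightarrow> 0 < x $ j) \<and>
    (\<forall>j. 0 < v $ j \<longrightarrow> x $ j < 1)"
proof -
  \<comment> \<open>With \<open>k - 1\<close> ones placed, the remaining negative positions share a
    mass of 1 equally. There are between 2 and \<open>i + 1\<close> of them.\<close>
  obtain A where A: "A \<subseteq> negs v" "card A = k - 1"
    using obtain_subset_with_card_n[of "k - 1" "negs v"] assms by force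
  define S where "S = negs v - A"
  have cS: "card S = card (negs v) - (k - 1)"
    unfolding S_def using A by (simp add: card_Diff_subset)
  then have S2: "card S \<ge> 2" using assms by simp
  define x :: "real ^ 'n" where
    "x = (\<chi> j. if j \<in> A then 1 else if j \<in> S then 1 / real (card S) else 0)"
  have dis: "A \<inter> S = {}" by (auto simp: S_def)
  have "(\<Sum>j\<in>UNIV. x $ j) = (\<Sum>j\<in>A \<union> S. x $ j)"
    by (rule sum.mono_neutral_right) (auto simp: x_def)
  also have "\<dots> = (\<Sum>j\<in>A. x $ j) + (\<Sum>j\<in>S. x $ j)"
    using dis by (simp add: sum.union_disjoint)
  also have "(\<Sum>j\<in>A. x $ j) = real (card A)" by (simp add: x_def)
  also have "(\<Sum>j\<in>S. x $ j) = (\<Sum>j\<in>S. 1 / real (card S))"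
    using dis by (intro sum.cong) (auto simp: x_def)
  also have "\<dots> = 1" using S2 by auto
  finally have "(\<Sum>j\<in>UNIV. x $ j) = real k" using A assms by simp
  then have "x \<in> slab k" using S2 by (auto simp: slab_def x_def)
  moreover have "fracs x \<subseteq> S" by (auto simp: fracs_def x_def split: if_splits)
  then have "card (fracs x) \<le> i + 1"
    using cS assms card_mono[of S "fracs x"] by simp
  moreover have "0 < x $ j" if "v $ j < 0" for j
    using that S2 by (auto simp: x_def S_def negs_def)
  moreover have "x $ j < 1" if "0 < v $ j" for j
    using that A by (auto simp: x_def S_def negs_def)
  ultimately show ?thesis by blast
qed

text \<open>A vector that does not escape is a feasible direction at a point of a face of dimension
  at most \<open>i\<close>. Too many positive entries reduce to too many negative ones by the
  reflection \<open>1 - x\<close>, which exchanges \<open>k\<close> and \<open>n - k\<close>; if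
  neither occurs, a vertex suffices.\<close>

lemma ex_slab_point:
  fixes v :: "real ^ 'n"
  assumes k: "1 \<le> k" "k < CARD('n)" and ne: "\<not> escapes k i v"
  shows "\<exists>x\<in>slab k. card (fracs x) \<le> i + 1 \<and> (\<forall>j. v $ j < 0 \<longrightarrow> 0 < x $ j) \<and>
    (\<forall>j. 0 < v $ j \<longrightarrow> x $ j < 1)"
proof -
  have neg: "card (negs v) \<le> k + i" and pos: "card (poss v) + k \<le> CARD('n) + i"
    using ne by (auto simp: escapes_def)
  have flip: "negs (- v) = poss v" by (auto simp: negs_def poss_def)
  consider "k < card (negs v)" | "CARD('n) - k < card (poss v)"
    | "card (negs v) \<le> k" "card (poss v) \<le> CARD('n) - k" by linarith
  then show ?thesis
  proof cases
    case 1
    then show ?thesis using ex_slab_point_negs k neg by blast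
  next
    case 2
    then have bounds: "1 \<le> CARD('n) - k" "CARD('n) - k < card (poss v)"
      "card (poss v) \<le> CARD('n) - k + i"
      using k pos by auto
    then obtain x where x: "x \<in> slab (CARD('n) - k)" "card (fracs x) \<le> i + 1"
      "\<And>j. - v $ j < 0 \<Longrightarrow> 0 < x $ j" "\<And>j. 0 < - v $ j \<Longrightarrow> x $ j < 1"
      using ex_slab_point_negs[of "CARD('n) - k" "- v" i] bounds unfolding flip by auto
    define x' where "x' = (\<chi> j. 1 - x $ j)"
    have "fracs x' = fracs x" by (auto simp: fracs_def x'_def)
    moreover have "x' \<in> slab k"
      using x(1) k by (auto simp: slab_def x'_def sum_subtractf of_nat_diff)
    ultimately show ?thesis using x by (intro bexI[of _ x']) (auto simp: x'_def)
  next
    case 3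
    have "card (negs v) \<le> k" "k \<le> card (- poss v)" "negs v \<subseteq> - poss v"
      using 3 k by (auto simp: Compl_eq_Diff_UNIV card_Diff_subset negs_def poss_def)
    then obtain A where A: "negs v \<subseteq> A" "A \<subseteq> - poss v" "card A = k"
      using exists_subset_between[of "negs v" k "- poss v"] by auto
    define x :: "real ^ 'n" where "x = (\<chi> j. if j \<in> A then 1 else 0)"
    have "(\<Sum>j\<in>UNIV. x $ j) = (\<Sum>j\<in>A. x $ j)"
      by (rule sum.mono_neutral_right) (auto simp: x_def)
    then have "x \<in> slab k" using A by (auto simp: slab_def x_def)
    moreover have "fracs x = {}" by (auto simp: fracs_def x_def)
    ultimately show ?thesis using A by (intro bexI[of _ x]) (auto simp: x_def negs_def poss_def)
  qed
qed

text \<open>This turns the geometry of faces into a count of signs on the kernel, the only form in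
  which it is used from here on.\<close>

lemma preserves_skeleton_slab_iff:
  fixes \<pi> :: "real ^ 'n \<Rightarrow> 'b::real_vector"
  assumes L: "linear L" and \<pi>: "\<And>x. x \<in> slab k \<Longrightarrow> \<pi> x = L x + c"
    and k: "1 \<le> k" "k < CARD('n)"
  shows "preserves_skeleton \<pi> (slab k) (int i) \<longleftrightarrow>
    (\<forall>v. (\<Sum>j\<in>UNIV. v $ j) = 0 \<and> L v = 0 \<and> v \<noteq> 0 \<longrightarrow> escapes k i v)"
    (is "?lhs \<longleftrightarrow> ?rhs")
proof
  assume ?lhs
  show ?rhs
  proof (intro allI impI, rule ccontr)
    fix v assume v: "(\<Sum>j\<in>UNIV. v $ j) = 0 \<and> L v = 0 \<and> v \<noteq> 0" and "\<not> escapes k i v"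
    then obtain x where "x \<in> slab k" "card (fracs x) \<le> i + 1"
      "\<And>j. v $ j < 0 \<Longrightarrow> 0 < x $ j" "\<And>j. 0 < v $ j \<Longrightarrow> x $ j < 1"
      using ex_slab_point[OF k] by metis
    then show False
      using preserves_skeleton_kernel[OF L \<pi> \<open>?lhs\<close>, of x v] v by blast
  qed
next
  assume ?rhs
  then show ?lhs
    unfolding preserves_skeleton_def
    using strictly_preserved_slab[OF L \<pi>] by blast
qed

section \<open>Reduction to families of linear functionals\<close>

text \<open>The vectors \<open>a e\<close> are the coordinate functionals of the linear part of the
  projection. The \<open>itself\<close> argument supplies the dimension \<open>n\<close>, which the
  numbers \<open>k\<close>, \<open>i\<close>, \<open>d\<close> do not determine.\<close>

definition realizable :: "'n::finite itself \<Rightarrow> nat \<Rightarrow> nat \<Rightarrow> nat \<Rightarrow> bool" where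
  "realizable _ k i d \<longleftrightarrow> (\<exists>a :: nat \<Rightarrow> real ^ 'n. \<forall>v.
     (\<Sum>j\<in>UNIV. v $ j) = 0 \<and> (\<forall>e<d. a e \<bullet> v = 0) \<and> v \<noteq> 0 \<longrightarrow> escapes k i v)"

lemma lookup_scaleR_poly_mapping:
  "Poly_Mapping.lookup (r *\<^sub>R x) m = r *\<^sub>R Poly_Mapping.lookup (x :: 'a \<Rightarrow>\<^sub>0 'b::real_vector) m"
proof -
  have "finite {m. r *\<^sub>R Poly_Mapping.lookup x m \<noteq> 0}"
    by (rule finite_subset[OF _ finite_keys[of x]]) (auto simp: in_keys_iff)
  then show ?thesis
    by (simp add: scaleR_poly_mapping_def Abs_poly_mapping_inverse)
qed

text \<open>The adjoint represents each coordinate of the linear part as an inner product;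
  conversely, \<open>d\<close> inner products are assembled into a map to
  \<open>coord_space d\<close>.\<close>

lemma realizable_iff:
  assumes k: "1 \<le> k" "k < CARD('n::finite)"
  shows "(\<exists>\<pi> :: real ^ 'n \<Rightarrow> (nat \<Rightarrow>\<^sub>0 real). affine_map_on (slab k) \<pi> \<and>
      \<pi> ` slab k \<subseteq> coord_space d \<and> preserves_skeleton \<pi> (slab k) (int i))
    \<longleftrightarrow> realizable TYPE('n) k i d"
proof
  assume "\<exists>\<pi> :: real ^ 'n \<Rightarrow> (nat \<Rightarrow>\<^sub>0 real). affine_map_on (slab k) \<pi> \<and>
      \<pi> ` slab k \<subseteq> coord_space d \<and> preserves_skeleton \<pi> (slab k) (int i)"
  then obtain \<pi> :: "real ^ 'n \<Rightarrow> (nat \<Rightarrow>\<^sub>0 real)" and L c where L: "linear L"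
    and \<pi>: "\<And>x. x \<in> slab k \<Longrightarrow> \<pi> x = L x + c" and sub: "\<pi> ` slab k \<subseteq> coord_space d"
    and pres: "preserves_skeleton \<pi> (slab k) (int i)"
    unfolding affine_map_on_def by blast
  define f where "f e v = Poly_Mapping.lookup (L v) e" for e v
  have f: "linear (f e)" for e
    unfolding f_def
    by (intro linearI) (auto simp: linear_add[OF L] linear_scale[OF L] lookup_add
        lookup_scaleR_poly_mapping)
  have fa: "adjoint (f e) 1 \<bullet> v = f e v" for e v
    using adjoint_works[OF f, where x = v and y = 1] by (simp add: inner_commute)
  have "escapes k i v"
    if v: "(\<Sum>j\<in>UNIV. v $ j) = 0" "\<forall>e<d. adjoint (f e) 1 \<bullet> v = 0" "v \<noteq> 0" for v
  proof -
    \<comment> \<open>Only the image of the slab is known to lie in \<open>coord_space d\<close>,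
      not the range of \<open>L\<close>. A step along \<open>v\<close> from the barycentre stays in
      the slab, so the coordinates of \<open>L v\<close> from \<open>d\<close> on vanish as
      well.\<close>
    let ?x = "(\<chi> j. real k / real CARD('n)) :: real ^ 'n"
    have x: "?x \<in> slab k" using k by (auto simp: slab_def divide_le_eq)
    obtain e where e: "e > 0" "?x + e *\<^sub>R v \<in> slab k"
      using slab_perturb[OF x v(1)] k by (auto simp: divide_less_eq)
    have "Poly_Mapping.lookup (L v) m = 0" for m
    proof (cases "m < d")
      case True
      then show ?thesis using v(2) fa by (simp add: f_def)
    next
      case False
      have "Poly_Mapping.lookup (\<pi> y) m = 0" if "y \<in> slab k" for y
        using sub that False by (force simp: coord_space_def in_keys_iff)
      then have "Poly_Mapping.lookup (\<pi> (?x + e *\<^sub>R v) - \<pi> ?x) m = 0"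
        using x e by (simp add: lookup_minus)
      moreover have "\<pi> (?x + e *\<^sub>R v) - \<pi> ?x = e *\<^sub>R L v"
        using \<pi>[OF x] \<pi>[OF e(2)] by (simp add: linear_add[OF L] linear_scale[OF L])
      ultimately show ?thesis using e(1) by (simp add: lookup_scaleR_poly_mapping)
    qed
    then have "L v = 0" by (intro poly_mapping_eqI) simp
    then show ?thesis
      using preserves_skeleton_slab_iff[OF L \<pi> k] pres v by blast
  qed
  then show "realizable TYPE('n) k i d"
    unfolding realizable_def by (intro exI[of _ "\<lambda>e. adjoint (f e) 1"]) blast
next
  assume "realizable TYPE('n) k i d"
  then obtain a :: "nat \<Rightarrow> real ^ 'n" where
    a: "\<And>v. (\<Sum>j\<in>UNIV. v $ j) = 0 \<Longrightarrow> (\<And>e. e < d \<Longrightarrow> a e \<bullet> v = 0) \<Longrightarrow> v \<noteq> 0 \<Longrightarrow> escapes k i v"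
    unfolding realizable_def by blast
  define L where "L v = (\<Sum>e<d. Poly_Mapping.single e (a e \<bullet> v))" for v
  have lookL: "Poly_Mapping.lookup (L v) m = (if m < d then a m \<bullet> v else 0)" for v m
    by (simp add: L_def lookup_sum lookup_single when_def)
  have L: "linear L"
    by (intro linearI poly_mapping_eqI)
      (auto simp: lookL lookup_add lookup_scaleR_poly_mapping inner_add_right)
  have "preserves_skeleton L (slab k) (int i)"
  proof (subst preserves_skeleton_slab_iff[OF L _ k])
    show "L x = L x + 0" for x by simp
    show "\<forall>v. (\<Sum>j\<in>UNIV. v $ j) = 0 \<and> L v = 0 \<and> v \<noteq> 0 \<longrightarrow> escapes k i v"
    proof (intro allI impI)
      fix v assume v: "(\<Sum>j\<in>UNIV. v $ j) = 0 \<and> L v = 0 \<and> v \<noteq> 0"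
      have "a e \<bullet> v = 0" if "e < d" for e
        using lookL[of v e] v that by simp
      then show "escapes k i v" using a v by blast
    qed
  qed
  moreover have "affine_map_on (slab k) L"
    using L by (auto simp: affine_map_on_def intro!: exI[of _ L] exI[of _ 0])
  moreover have "L ` slab k \<subseteq> coord_space d"
    by (auto simp: coord_space_def in_keys_iff lookL split: if_splits)
  ultimately show "\<exists>\<pi> :: real ^ 'n \<Rightarrow> (nat \<Rightarrow>\<^sub>0 real). affine_map_on (slab k) \<pi> \<and>
      \<pi> ` slab k \<subseteq> coord_space d \<and> preserves_skeleton \<pi> (slab k) (int i)" by blast
qed

lemma negs_uminus: "negs (- v) = poss v" and poss_uminus: "poss (- v) = negs v"
  by (auto simp: negs_def poss_def)

lemma card_negs_poss_le:
  fixes v :: "real ^ 'n"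
  shows "card (negs v) + card (poss v) \<le> CARD('n)"
proof -
  have "card (negs v) + card (poss v) = card (negs v \<union> poss v)"
    by (rule card_Un_disjoint[symmetric]) (auto simp: negs_def poss_def)
  also have "\<dots> \<le> CARD('n)" by (rule card_mono) auto
  finally show ?thesis .
qed

text \<open>Negating \<open>v\<close> preserves the kernel and swaps the two alternatives of
  \<open>escapes\<close> under the exchange of \<open>k\<close> and \<open>n - k\<close>.\<close>

lemma realizable_complement:
  assumes "k \<le> CARD('n::finite)"
  shows "realizable TYPE('n) (CARD('n) - k) i d \<longleftrightarrow> realizable TYPE('n) k i d"
proof -
  have esc: "escapes (CARD('n) - k) i v \<longleftrightarrow> escapes k i (- v)" for v :: "real ^ 'n"
    using assms by (auto simp: escapes_def negs_uminus poss_uminus)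
  have "(\<forall>v. (\<Sum>j\<in>UNIV. v $ j) = 0 \<and> (\<forall>e<d. a e \<bullet> v = 0) \<and> v \<noteq> 0 \<longrightarrow> escapes (CARD('n) - k) i v)
    \<longleftrightarrow> (\<forall>v. (\<Sum>j\<in>UNIV. v $ j) = 0 \<and> (\<forall>e<d. a e \<bullet> v = 0) \<and> v \<noteq> 0 \<longrightarrow> escapes k i v)"
    (is "(\<forall>v. ?K v \<longrightarrow> ?P v) \<longleftrightarrow> (\<forall>v. ?K v \<longrightarrow> ?Q v)") for a :: "nat \<Rightarrow> real ^ 'n"
  proof -
    have K: "?K v \<longleftrightarrow> ?K (- v)" for v by (simp add: sum_negf)
    have PQ: "?P v \<longleftrightarrow> ?Q (- v)" for v by (rule esc)
    show ?thesis
    proof (intro iffI allI impI)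
      fix v assume "\<forall>v. ?K v \<longrightarrow> ?P v" "?K v"
      then have "?P (- v)" using K by blast
      then show "?Q v" using PQ[of "- v"] by simp
    next
      fix v assume "\<forall>v. ?K v \<longrightarrow> ?Q v" "?K v"
      then have "?Q (- v)" using K by blast
      then show "?P v" using PQ by blast
    qed
  qed
  then show ?thesis unfolding realizable_def by simp
qed

section \<open>Lower bounds from connectedness and dimension\<close>

text \<open>Strict signs survive small perturbations: the set is a union of finite intersections of
  open half-spaces.\<close>

lemma open_card_negs_ge: "open {v :: real ^ 'n. q \<le> card (negs v)}"
proof -
  have "{v :: real ^ 'n. q \<le> card (negs v)} = (\<Union>J\<in>{J. q \<le> card J}. \<Inter>j\<in>J. {v. v $ j < 0})"
  proof (intro equalityI subsetI)
    fix v :: "real ^ 'n" assume "v \<in> {v. q \<le> card (negs v)}"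
    then show "v \<in> (\<Union>J\<in>{J. q \<le> card J}. \<Inter>j\<in>J. {v. v $ j < 0})"
      by (intro UN_I[of "negs v"]) (auto simp: negs_def)
  next
    fix v :: "real ^ 'n" assume "v \<in> (\<Union>J\<in>{J. q \<le> card J}. \<Inter>j\<in>J. {v. v $ j < 0})"
    then obtain J where "q \<le> card J" "J \<subseteq> negs v" by (auto simp: negs_def)
    then show "v \<in> {v. q \<le> card (negs v)}"
      using card_mono[of "negs v" J] by simp
  qed
  moreover have "open (\<Inter>j\<in>J. {v :: real ^ 'n. v $ j < 0})" for J :: "'n set"
    by (intro open_INT ballI open_Collect_less continuous_intros) auto
  ultimately show ?thesis by (simp add: open_UN)
qed

lemma open_card_poss_ge: "open {v :: real ^ 'n. q \<le> card (poss v)}"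
proof -
  have "open ((\<lambda>v. - v) -` {v :: real ^ 'n. q \<le> card (negs v)})"
    by (intro open_vimage open_card_negs_ge continuous_intros)
  then show ?thesis by (simp add: vimage_def negs_uminus)
qed

lemma ex_orthogonal_nonzero:
  fixes A :: "(real ^ 'n) set"
  assumes "finite A" "card A < CARD('n)"
  shows "\<exists>v. v \<noteq> 0 \<and> (\<forall>a\<in>A. a \<bullet> v = 0)"
proof -
  have "dim A \<le> card A" using assms(1) by (rule dim_le_card')
  then have "dim A < DIM(real ^ 'n)" using assms(2) by simp
  then obtain v where "v \<noteq> 0" "\<And>y. y \<in> span A \<Longrightarrow> orthogonal v y"
    using orthogonal_to_subspace_exists[of A] by blast
  then have "v \<noteq> 0 \<and> (\<forall>a\<in>A. a \<bullet> v = 0)"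
    by (metis inner_commute orthogonal_def span_base)
  then show ?thesis ..
qed

text \<open>The kernel \<open>K\<close> of the functionals in \<open>A\<close> has dimension at
  least 2, so \<open>K - {0}\<close> is connected and cannot meet both of the disjoint open sets
  \<open>U\<close> and \<open>V\<close> that cover it. Negation maps \<open>U\<close> into
  \<open>V\<close>, so \<open>U\<close> is missed.\<close>

lemma escapes_both_signs:
  fixes A :: "(real ^ 'n) set"
  assumes A: "finite A" "card A + 2 \<le> CARD('n)" and k: "2 * k \<le> CARD('n)"
    and esc: "\<And>v. v \<noteq> 0 \<Longrightarrow> (\<And>a. a \<in> A \<Longrightarrow> a \<bullet> v = 0) \<Longrightarrow> escapes k i v"
    and v: "v \<noteq> 0" "\<And>a. a \<in> A \<Longrightarrow> a \<bullet> v = 0"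
  shows "k + i < card (negs v) \<and> k + i < card (poss v)"
proof -
  define K where "K = {v. \<forall>a\<in>A. a \<bullet> v = 0}"
  have K: "subspace K"
    by (auto simp: K_def subspace_def inner_add_right)
  have esc': "escapes k i v" if "v \<in> K - {0}" for v
    using that esc by (auto simp: K_def)
  have minus: "- v \<in> K - {0}" if "v \<in> K - {0}" for v
    using that by (auto simp: K_def)
  have "K = {y \<in> UNIV. \<forall>x\<in>span A. orthogonal x y}"
  proof (intro equalityI subsetI CollectI conjI ballI)
    fix y x assume y: "y \<in> K" and x: "x \<in> span A"
    have "orthogonal y x"
      using y by (intro orthogonal_to_span[OF x]) (simp add: K_def orthogonal_def inner_commute)
    then show "orthogonal x y" by (simp add: orthogonal_commute)
  next
    fix y assume "y \<in> {y \<in> UNIV. \<forall>x\<in>span A. orthogonal x y}"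
    then have "a \<bullet> y = 0" if "a \<in> A" for a
      using span_base[OF that] unfolding orthogonal_def by blast
    then show "y \<in> K" by (simp add: K_def)
  qed simp
  then have "dim K + dim (span A) = CARD('n)"
    using dim_subspace_orthogonal_to_vectors[of "span A" UNIV] by simp
  moreover have "dim (span A) \<le> card A" using A by (simp add: dim_le_card')
  \<comment> \<open>A convex set remains connected without a point unless its affine dimension is
    1.\<close>
  ultimately have "aff_dim K \<noteq> 1" using A aff_dim_subspace[OF K] by simp
  then have conn: "connected (K - {0})"
    using K by (intro connected_punctured_convex subspace_imp_convex)
  define q where "q = CARD('n) + i + 1 - k"
  have q: "CARD('n) + i < m + k \<longleftrightarrow> q \<le> m" for m using k by (auto simp: q_def)
  define U where "U = {v :: real ^ 'n. q \<le> card (negs v)}"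
  define V where "V = {v :: real ^ 'n. k + i + 1 \<le> card (negs v)} \<inter> {v. k + i + 1 \<le> card (poss v)}
    \<union> {v. q \<le> card (poss v)}"
  have "open U" unfolding U_def by (rule open_card_negs_ge)
  moreover have "open V"
    unfolding V_def by (intro open_Un open_Int open_card_negs_ge open_card_poss_ge)
  moreover have "U \<inter> V \<inter> (K - {0}) = {}"
  proof -
    \<comment> \<open>A vector in both sets would have at least \<open>q\<close> negative and at
      least \<open>k + i + 1\<close> or \<open>q\<close> positive entries. Both totals exceed
      \<open>n\<close>: the first is \<open>n + 2 * i + 2\<close>, the second is no smaller since
      \<open>2 * k \<le> n\<close>.\<close>
    have "v \<notin> V" if "v \<in> U" for v :: "real ^ 'n"
      using that card_negs_poss_le[of v] k by (auto simp: U_def V_def q_def)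
    then show ?thesis by blast
  qed
  moreover have "K - {0} \<subseteq> U \<union> V"
  proof
    fix v assume "v \<in> K - {0}"
    then have "escapes k i v" "escapes k i (- v)" using esc' minus by auto
    then show "v \<in> U \<union> V"
      by (auto simp: U_def V_def escapes_def negs_uminus poss_uminus q)
  qed
  ultimately have dich: "U \<inter> (K - {0}) = {} \<or> V \<inter> (K - {0}) = {}"
    using connectedD[OF conn, of U V] by blast
  have noU: "w \<notin> U" if w: "w \<in> K - {0}" for w
  proof
    assume "w \<in> U"
    then have "- w \<in> V" by (simp add: U_def V_def poss_uminus)
    then show False using dich minus[OF w] \<open>w \<in> U\<close> w by blast
  qed
  have "v \<in> K - {0}" using v by (simp add: K_def)
  then have "v \<notin> U" "- v \<notin> U" "escapes k i v" "escapes k i (- v)"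
    using noU esc' minus by blast+
  then show ?thesis
    by (auto simp: U_def escapes_def negs_uminus poss_uminus q)
qed

lemma card_functionals_ge:
  fixes A :: "(real ^ 'n) set"
  assumes A: "finite A" "card A + 2 \<le> CARD('n)" and k: "2 * k \<le> CARD('n)"
    and esc: "\<And>v. v \<noteq> 0 \<Longrightarrow> (\<And>a. a \<in> A \<Longrightarrow> a \<bullet> v = 0) \<Longrightarrow> escapes k i v"
  shows "2 * k + 2 * i + 1 \<le> card A"
proof -
  \<comment> \<open>The largest number of coordinates that can be forced to vanish while counting
    functionals still guarantees a nonzero \<open>v\<close>. Its support then has at most
    \<open>card A + 1\<close> elements, which must hold \<open>k + i + 1\<close> entries of each
    sign.\<close>
  obtain J :: "'n set" where J: "card J = CARD('n) - 1 - card A"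
    using obtain_subset_with_card_n[of "CARD('n) - 1 - card A" "UNIV :: 'n set"] by auto
  let ?A = "A \<union> (\<lambda>j. axis j 1) ` J"
  have "card ?A \<le> card A + card J"
    by (meson add_le_mono card_Un_le card_image_le finite le_refl le_trans)
  then have "card ?A < CARD('n)" using J A by simp
  then obtain v where v: "v \<noteq> 0" "\<And>a. a \<in> ?A \<Longrightarrow> a \<bullet> v = 0"
    using ex_orthogonal_nonzero[of ?A] A by auto
  have both: "k + i < card (negs v)" "k + i < card (poss v)"
    using escapes_both_signs[OF A k esc, of v] v by auto
  have "v $ j = 0" if "j \<in> J" for j
    using v(2)[of "axis j 1"] that by (simp add: inner_axis')
  then have sub: "negs v \<union> poss v \<subseteq> - J" by (auto simp: negs_def poss_def)
  have "card (negs v) + card (poss v) = card (negs v \<union> poss v)"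
    by (rule card_Un_disjoint[symmetric]) (auto simp: negs_def poss_def)
  also have "\<dots> \<le> card (- J)" using sub by (rule card_mono[rotated]) simp
  also have "\<dots> = card A + 1"
    using J A by (simp add: Compl_eq_Diff_UNIV card_Diff_subset)
  finally show ?thesis using both by simp
qed

text \<open>Adjoining the all-ones vector absorbs the condition of sum 0, whence
  \<open>d + 1\<close> functionals.\<close>

lemma realizable_functionals:
  assumes "realizable TYPE('n::finite) k i d"
  shows "\<exists>A :: (real ^ 'n) set. finite A \<and> card A \<le> d + 1 \<and>
    (\<forall>v. (\<forall>a\<in>A. a \<bullet> v = 0) \<longrightarrow> (\<Sum>j\<in>UNIV. v $ j) = 0 \<and> (v \<noteq> 0 \<longrightarrow> escapes k i v))"
proof -
  obtain a :: "nat \<Rightarrow> real ^ 'n" where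
    a: "\<And>v. (\<Sum>j\<in>UNIV. v $ j) = 0 \<Longrightarrow> (\<And>e. e < d \<Longrightarrow> a e \<bullet> v = 0) \<Longrightarrow> v \<noteq> 0 \<Longrightarrow> escapes k i v"
    using assms unfolding realizable_def by blast
  let ?A = "insert 1 (a ` {..<d})"
  have one: "1 \<bullet> v = (\<Sum>j\<in>UNIV. v $ j)" for v :: "real ^ 'n"
    by (simp add: inner_vec_def)
  show ?thesis
  proof (intro exI[of _ ?A] conjI allI impI)
    have "card ?A \<le> Suc (card (a ` {..<d}))" by (simp add: card_insert_if)
    also have "card (a ` {..<d}) \<le> d" using card_image_le[of "{..<d}" a] by simp
    finally show "card ?A \<le> d + 1" by simp
  next
    fix v :: "real ^ 'n" assume v: "\<forall>w\<in>?A. w \<bullet> v = 0"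
    show sum0: "(\<Sum>j\<in>UNIV. v $ j) = 0" using v one by simp
    show "escapes k i v" if "v \<noteq> 0" using a[OF sum0 _ that] v by blast
  qed simp
qed

lemma realizable_lower:
  assumes r: "realizable TYPE('n::finite) k i d" and k: "2 * k \<le> CARD('n)"
    and d: "d + 3 \<le> CARD('n)"
  shows "2 * k + 2 * i \<le> d"
proof -
  obtain A :: "(real ^ 'n) set" where A: "finite A" "card A \<le> d + 1"
    "\<forall>v. (\<forall>a\<in>A. a \<bullet> v = 0) \<longrightarrow> (\<Sum>j\<in>UNIV. v $ j) = 0 \<and> (v \<noteq> 0 \<longrightarrow> escapes k i v)"
    using realizable_functionals[OF r] by blast
  have "card A + 2 \<le> CARD('n)" using A(2) d by simp
  moreover have "escapes k i v" if "v \<noteq> 0" "\<And>a. a \<in> A \<Longrightarrow> a \<bullet> v = 0" for v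
    using A(3) that by blast
  ultimately have "2 * k + 2 * i + 1 \<le> card A"
    using card_functionals_ge[OF A(1) _ k] by blast
  then show ?thesis using A(2) by simp
qed

text \<open>A nonzero kernel vector exists, and \<open>n\<close> is too small for
  \<open>k + i + 1\<close> entries of both signs. So one sign has at least
  \<open>n - k + i + 1\<close> entries, and the other has at least one because the sum is 0.\<close>

lemma realizable_lower_tight:
  assumes r: "realizable TYPE('n::finite) k i d" and k: "2 * k \<le> CARD('n)"
    and n: "CARD('n) < 2 * k + 2 * i + 2" and d: "d + 2 \<le> CARD('n)"
  shows "i + 2 \<le> k"
proof -
  obtain A :: "(real ^ 'n) set" where A: "finite A" "card A \<le> d + 1"
    "\<forall>v. (\<forall>a\<in>A. a \<bullet> v = 0) \<longrightarrow> (\<Sum>j\<in>UNIV. v $ j) = 0 \<and> (v \<noteq> 0 \<longrightarrow> escapes k i v)"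
    using realizable_functionals[OF r] by blast
  obtain v where v: "v \<noteq> 0" "\<And>a. a \<in> A \<Longrightarrow> a \<bullet> v = 0"
    using ex_orthogonal_nonzero[of A] A d by auto
  have "escapes k i v" "escapes k i (- v)"
    using A(3)[rule_format, of v] A(3)[rule_format, of "- v"] v by auto
  moreover have "negs v \<noteq> {}" "poss v \<noteq> {}"
  proof -
    have sum0: "(\<Sum>j\<in>UNIV. v $ j) = 0" using A(3) v by blast
    obtain j where j: "v $ j \<noteq> 0" using v by (auto simp: vec_eq_iff)
    show "negs v \<noteq> {}"
    proof
      assume "negs v = {}"
      then have "\<And>j. 0 \<le> v $ j" by (simp add: negs_def not_less set_eq_iff)
      then show False using sum_nonneg_eq_0_iff[of UNIV "\<lambda>j. v $ j"] sum0 j by simp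
    qed
    show "poss v \<noteq> {}"
    proof
      assume "poss v = {}"
      then have "\<And>j. v $ j \<le> 0" by (simp add: poss_def not_less set_eq_iff)
      then show False using sum_nonneg_eq_0_iff[of UNIV "\<lambda>j. - v $ j"] sum0 j by (simp add: sum_negf)
    qed
  qed
  then have "card (negs v) \<ge> 1" "card (poss v) \<ge> 1"
    by (simp_all add: Suc_le_eq card_gt_0_iff)
  ultimately show ?thesis
    using card_negs_poss_le[of v] n by (auto simp: escapes_def negs_uminus poss_uminus)
qed

section \<open>Constructions from the moment curve and from a line\<close>

lemma sum_poly_moments:
  fixes v :: "real ^ 'n" and t :: "'n \<Rightarrow> real"
  assumes "\<And>e. e \<le> d \<Longrightarrow> (\<Sum>j\<in>UNIV. v $ j * t j ^ e) = 0" and "degree p \<le> d"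
  shows "(\<Sum>j\<in>UNIV. v $ j * poly p (t j)) = 0"
proof -
  have "(\<Sum>j\<in>UNIV. v $ j * poly p (t j)) = (\<Sum>j\<in>UNIV. \<Sum>e\<le>degree p. coeff p e * (v $ j * t j ^ e))"
    by (simp add: poly_altdef sum_distrib_left algebra_simps)
  also have "\<dots> = (\<Sum>e\<le>degree p. coeff p e * (\<Sum>j\<in>UNIV. v $ j * t j ^ e))"
    by (subst sum.swap) (simp add: sum_distrib_left)
  also have "\<dots> = 0" using assms by (intro sum.neutral) auto
  finally show ?thesis .
qed

text \<open>The argument behind the neighborliness of cyclic polytopes: paired with
  \<open>p\<close>, the vector gives a vanishing sum of nonnegative terms. This rules out positive
  entries, and the zeroth moment then rules out negative ones.\<close>

lemma moments_card_negs:
  fixes v :: "real ^ 'n" and t :: "'n \<Rightarrow> real"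
  assumes t: "inj t" and mom: "\<And>e. e \<le> 2 * m \<Longrightarrow> (\<Sum>j\<in>UNIV. v $ j * t j ^ e) = 0"
    and m: "card (negs v) \<le> m"
  shows "v = 0"
proof -
  \<comment> \<open>A nonnegative polynomial vanishing exactly at the parameters of the negative entries.\<close>
  define p where "p = (\<Prod>j\<in>negs v. [:- t j, 1:] ^ 2)"
  have "degree p \<le> (\<Sum>j\<in>negs v. degree ([:- t j, 1:] ^ 2))"
    unfolding p_def using degree_prod_sum_le[of "negs v"] by (simp add: o_def)
  also have "\<dots> = 2 * card (negs v)" by (simp add: degree_power_eq)
  finally have "degree p \<le> 2 * m" using m by simp
  then have sum0: "(\<Sum>j\<in>UNIV. v $ j * poly p (t j)) = 0"
    using sum_poly_moments[of "2 * m" v t p] mom by blast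
  have poly_p: "poly p x = (\<Prod>j\<in>negs v. (x - t j) ^ 2)" for x
    by (simp add: p_def poly_prod)
  have "0 \<le> v $ j * poly p (t j)" for j
  proof (cases "j \<in> negs v")
    case True
    then have "poly p (t j) = 0" by (auto simp: poly_p)
    then show ?thesis by simp
  next
    case False
    then show ?thesis by (auto simp: negs_def poly_p intro!: mult_nonneg_nonneg prod_nonneg)
  qed
  then have zero: "v $ j * poly p (t j) = 0" for j
    using sum0 sum_nonneg_eq_0_iff[of UNIV "\<lambda>j. v $ j * poly p (t j)"] by simp
  have np: "v $ j \<le> 0" for j
  proof (rule ccontr)
    assume j: "\<not> v $ j \<le> 0"
    then have "poly p (t j) \<noteq> 0"
      using t by (auto simp: poly_p negs_def inj_eq)
    with zero[of j] j show False by simp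
  qed
  have "(\<Sum>j\<in>UNIV. v $ j) = 0" using mom[of 0] by simp
  then have "\<And>j. v $ j = 0"
    using sum_nonneg_eq_0_iff[of UNIV "\<lambda>j. - v $ j"] np by (simp add: sum_negf)
  then show ?thesis by (simp add: vec_eq_iff)
qed

text \<open>As in Lagrange interpolation, the polynomial vanishing at all parameters except
  \<open>t l\<close> isolates the entry \<open>v $ l\<close>.\<close>

lemma moments_injective:
  fixes v :: "real ^ 'n" and t :: "'n \<Rightarrow> real"
  assumes t: "inj t" and mom: "\<And>e. e \<le> CARD('n) - 1 \<Longrightarrow> (\<Sum>j\<in>UNIV. v $ j * t j ^ e) = 0"
  shows "v = 0"
proof -
  have "v $ l = 0" for l
  proof -
    define p where "p = (\<Prod>j\<in>UNIV - {l}. [:- t j, 1:])"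
    have "degree p \<le> (\<Sum>j\<in>UNIV - {l}. degree [:- t j, 1:])"
      unfolding p_def using degree_prod_sum_le[of "UNIV - {l}" "\<lambda>j. [:- t j, 1:]"]
      by (simp only: o_def finite)
    also have "\<dots> = CARD('n) - 1" by (simp add: card_Diff_subset)
    finally have "degree p \<le> CARD('n) - 1" .
    then have "(\<Sum>j\<in>UNIV. v $ j * poly p (t j)) = 0"
      using sum_poly_moments[of "CARD('n) - 1" v t p] mom by blast
    also have "(\<Sum>j\<in>UNIV. v $ j * poly p (t j)) = (\<Sum>j\<in>{l}. v $ j * poly p (t j))"
      by (rule sum.mono_neutral_right) (auto simp: p_def poly_prod)
    finally have "v $ l * poly p (t l) = 0" by simp
    moreover have "poly p (t l) \<noteq> 0" using t by (auto simp: p_def poly_prod inj_eq)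
    ultimately show ?thesis by simp
  qed
  then show ?thesis by (simp add: vec_eq_iff)
qed

lemma realizable_moments:
  assumes "\<And>(v :: real ^ 'n) (t :: 'n \<Rightarrow> real).
    inj t \<Longrightarrow> v \<noteq> 0 \<Longrightarrow> (\<And>e. e \<le> d \<Longrightarrow> (\<Sum>j\<in>UNIV. v $ j * t j ^ e) = 0) \<Longrightarrow> escapes k i v"
  shows "realizable TYPE('n::finite) k i d"
proof -
  obtain t :: "'n \<Rightarrow> nat" where "inj t"
    using finite_imp_inj_to_nat_seg[of "UNIV :: 'n set"] by auto
  then have t: "inj (real \<circ> t)" by (simp add: inj_compose)
  \<comment> \<open>The exponents start at 1, since the zeroth moment is the condition of sum 0
    already built into \<open>realizable\<close>.\<close>
  define a :: "nat \<Rightarrow> real ^ 'n" where "a e = (\<chi> j. real (t j) ^ Suc e)" for e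
  show ?thesis
    unfolding realizable_def
  proof (intro exI[of _ a] allI impI)
    fix v :: "real ^ 'n"
    assume v: "(\<Sum>j\<in>UNIV. v $ j) = 0 \<and> (\<forall>e<d. a e \<bullet> v = 0) \<and> v \<noteq> 0"
    have "(\<Sum>j\<in>UNIV. v $ j * (real \<circ> t) j ^ e) = 0" if "e \<le> d" for e
    proof (cases e)
      case (Suc e')
      then have "a e' \<bullet> v = 0" using v that by simp
      then show ?thesis by (simp add: a_def inner_vec_def Suc mult.commute)
    qed (use v in simp)
    then show "escapes k i v" using assms[OF t] v by blast
  qed
qed

text \<open>All kernel vectors escape by the first alternative: with at most \<open>k + i\<close>
  negative entries they would be 0.\<close>

lemma realizable_cyclic: "realizable TYPE('n::finite) k i (2 * k + 2 * i)"
proof (rule realizable_moments)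
  fix v :: "real ^ 'n" and t :: "'n \<Rightarrow> real"
  assume "inj t" "v \<noteq> 0" "\<And>e. e \<le> 2 * k + 2 * i \<Longrightarrow> (\<Sum>j\<in>UNIV. v $ j * t j ^ e) = 0"
  then show "escapes k i v"
    using moments_card_negs[of t "k + i" v] by (fastforce simp: escapes_def)
qed

lemma realizable_full: "realizable TYPE('n::finite) k i (CARD('n) - 1)"
proof (rule realizable_moments)
  fix v :: "real ^ 'n" and t :: "'n \<Rightarrow> real"
  assume "inj t" "v \<noteq> 0" "\<And>e. e \<le> CARD('n) - 1 \<Longrightarrow> (\<Sum>j\<in>UNIV. v $ j * t j ^ e) = 0"
  then show "escapes k i v"
    using moments_injective[of t v] by simp
qed

text \<open>The kernel is a line whose nonzero vectors have \<open>n - 1\<close> equal entries.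
  Depending on their sign, the second or the first hypothesis makes the vector escape.\<close>

lemma realizable_line:
  assumes "i + 1 < k" "k + i + 1 < CARD('n::finite)"
  shows "realizable TYPE('n) k i (CARD('n) - 2)"
proof -
  obtain a :: 'n where True by simp
  have "card (UNIV - {a}) \<noteq> 0" using assms by (simp add: card_Diff_subset)
  then have "UNIV - {a} \<noteq> {}" by (metis card.empty)
  then obtain b where b: "b \<noteq> a" by blast
  have "card (UNIV - {a, b}) = CARD('n) - 2" using b by (simp add: card_Diff_subset)
  then have "card {..<CARD('n) - 2} = card (UNIV - {a, b})" by simp
  from finite_same_card_bij[OF _ _ this] obtain h where "bij_betw h {..<CARD('n) - 2} (UNIV - {a, b})"
    by (meson finite finite_lessThan)
  then have h: "h ` {..<CARD('n) - 2} = UNIV - {a, b}" by (rule bij_betw_imp_surj_on)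
  \<comment> \<open>These \<open>n - 2\<close> differences equate all coordinates other than
    \<open>b\<close>; the sum condition then determines the entry at \<open>b\<close>.\<close>
  define f :: "nat \<Rightarrow> real ^ 'n" where "f e = axis (h e) 1 - axis a 1" for e
  show ?thesis
    unfolding realizable_def
  proof (intro exI[of _ f] allI impI)
    fix v :: "real ^ 'n"
    assume v: "(\<Sum>j\<in>UNIV. v $ j) = 0 \<and> (\<forall>e<CARD('n) - 2. f e \<bullet> v = 0) \<and> v \<noteq> 0"
    have va: "v $ j = v $ a" if jb: "j \<noteq> b" for j
    proof (cases "j = a")
      case False
      then have "j \<in> h ` {..<CARD('n) - 2}" unfolding h using jb by simp
      then obtain e where e: "e < CARD('n) - 2" "h e = j" by (elim imageE) simp
      then have "f e \<bullet> v = 0" using v by blast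
      then show ?thesis by (simp add: f_def e inner_diff_left inner_axis')
    qed simp
    have "(\<Sum>j\<in>UNIV. v $ j) = v $ b + (\<Sum>j\<in>UNIV - {b}. v $ j)"
      by (rule sum.remove) auto
    also have "(\<Sum>j\<in>UNIV - {b}. v $ j) = (\<Sum>j\<in>UNIV - {b}. v $ a)"
      by (rule sum.cong) (auto simp: va)
    finally have vb: "v $ b + real (card (UNIV - {b})) * v $ a = 0" using v by simp
    have "v $ a \<noteq> 0"
    proof
      assume 0: "v $ a = 0"
      then have "v $ j = 0" for j using vb va by (cases "j = b") auto
      then show False using v by (simp add: vec_eq_iff)
    qed
    moreover have cb: "card (UNIV - {b}) + 1 = CARD('n)" by (simp add: card_Diff_subset)
    ultimately consider "v $ a < 0" | "v $ a > 0" by linarith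
    then show "escapes k i v"
    proof cases
      case 1
      then have "card (UNIV - {b}) \<le> card (negs v)"
        using va by (intro card_mono) (auto simp: negs_def)
      then show ?thesis using assms cb unfolding escapes_def by linarith
    next
      case 2
      then have "card (UNIV - {b}) \<le> card (poss v)"
        using va by (intro card_mono) (auto simp: poss_def)
      then show ?thesis using assms cb unfolding escapes_def by linarith
    qed
  qed
qed

section \<open>The minimal dimension\<close>

lemma min_preserving_dim_eq:
  assumes k: "1 \<le> k" "k < CARD('n::finite)"
  shows "min_preserving_dim (hypersimplex (int k) :: (real ^ 'n) set) (int i)
    = (LEAST d. realizable TYPE('n) k i d)"
  unfolding min_preserving_dim_def hypersimplex_eq_slab realizable_iff[OF k] ..

lemma Least_realizable:
  assumes k: "1 \<le> k" "2 * k \<le> CARD('n::finite)"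
  shows "(LEAST d. realizable TYPE('n) k i d) =
    (if 2 * k + 2 * i + 2 \<le> CARD('n) then 2 * k + 2 * i
     else if k \<le> i + 1 then CARD('n) - 1 else CARD('n) - 2)"
proof (intro Least_equality)
  let ?d = "if 2 * k + 2 * i + 2 \<le> CARD('n) then 2 * k + 2 * i
     else if k \<le> i + 1 then CARD('n) - 1 else CARD('n) - 2"
  show "realizable TYPE('n) k i ?d"
    using realizable_cyclic[where 'n='n, of k i] realizable_full[where 'n='n, of k i] 
      realizable_line[where 'n='n, of i k] k by auto
  fix d assume r: "realizable TYPE('n) k i d"
  show "?d \<le> d"
    \<comment> \<open>The first bound settles \<open>d + 3 \<le> n\<close>, and contradicts
      \<open>n < 2 * k + 2 * i + 2\<close> there. Otherwise \<open>d\<close> is at least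
      \<open>n - 2\<close>, and the second bound excludes \<open>d = n - 2\<close> when
      \<open>n < 2 * k + 2 * i + 2\<close> and \<open>k \<le> i + 1\<close>.\<close>
    using realizable_lower[OF r k(2)] realizable_lower_tight[OF r k(2)]
    by (cases "d + 3 \<le> CARD('n)"; cases "d + 2 \<le> CARD('n)") auto
qed

theorem theorem1p2:
  fixes n k i :: int
  assumes "n = int CARD('n::finite)"
    and "1 \<le> k" and "k \<le> n - 1"
    and "0 \<le> i" and "i \<le> n - 1"
  defines "d \<equiv> int (min_preserving_dim (hypersimplex k :: (real ^ 'n) set) i)"
  shows "(n \<ge> 2 * k + 2 * i + 2 \<longrightarrow> d = 2 * k + 2 * i) \<and>
         (n \<le> 2 * k - 2 * i - 2 \<longrightarrow> d = 2 * n - 2 * k + 2 * i) \<and>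
         (2 * k - 2 * i - 1 \<le> n \<and> n \<le> 2 * k + 2 * i + 1 \<and> k \<in> A_set n i \<longrightarrow> d = n - 1) \<and>
         (2 * k - 2 * i - 1 \<le> n \<and> n \<le> 2 * k + 2 * i + 1 \<and> k \<notin> A_set n i \<longrightarrow> d = n - 2)"
proof -
  obtain k' i' where ki: "k = int k'" "i = int i'"
    using assms(2,4) by (metis nonneg_int_cases order_trans zero_le_one)
  have k': "1 \<le> k'" "k' < CARD('n)" using assms ki by auto
  \<comment> \<open>Replacing \<open>k\<close> by the smaller of \<open>k\<close> and
    \<open>n - k\<close> gives \<open>2 * m \<le> n\<close>. The set \<open>A_set n i\<close> is
    symmetric under this exchange, so membership of \<open>k\<close> becomes
    \<open>m \<le> i + 1\<close>.\<close>
  define m where "m = min k' (CARD('n) - k')"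
  have m: "1 \<le> m" "2 * m \<le> CARD('n)" using k' by (auto simp: m_def)
  have "realizable TYPE('n) m i' = realizable TYPE('n) k' i'"
    using realizable_complement[where 'n='n and k=k' and i=i'] k' 
    by (auto simp: m_def min_def fun_eq_iff)
  then have "d = int (LEAST d. realizable TYPE('n) m i' d)"
    unfolding d_def ki min_preserving_dim_eq[OF k'] by simp
  then have d: "d = int (if 2 * m + 2 * i' + 2 \<le> CARD('n) then 2 * m + 2 * i'
      else if m \<le> i' + 1 then CARD('n) - 1 else CARD('n) - 2)"
    unfolding Least_realizable[OF m] .
  have A: "k \<in> A_set n i \<longleftrightarrow> int m \<le> i + 1"
    using k' unfolding A_set_def ki assms(1) m_def min_def by auto
  have d1: "d = 2 * int m + 2 * i" if "2 * int m + 2 * i + 2 \<le> n"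
    using that d assms(1) ki by simp
  have d2: "d = n - 1" if "\<not> 2 * int m + 2 * i + 2 \<le> n" "int m \<le> i + 1"
    using that d assms(1) ki k' by simp
  have d3: "d = n - 2" if "\<not> 2 * int m + 2 * i + 2 \<le> n" "\<not> int m \<le> i + 1"
    using that d assms(1) ki k' by simp
  \<comment> \<open>For \<open>m = n - k\<close>, the condition
    \<open>2 * m + 2 * i + 2 \<le> n\<close> reads \<open>n \<le> 2 * k - 2 * i - 2\<close>, which
    is the second case of the formula.\<close>
  have "int m = k \<and> 2 * k \<le> n \<or> int m = n - k \<and> n < 2 * k"
    using k' assms(1) ki by (auto simp: m_def min_def)
  then show ?thesis
    unfolding A using d1 d2 d3 assms(4) by (smt (verit))
qed

end
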